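(* Let $\mathcal{D}\subseteq\mathbb{R}^n$ be open, convex and downward (i.e. $x\in\mathcal{D}$ and $y\leq x$ imply $y\in\mathcal{D}$). If $f\colon\mathcal{D}\to\mathcal{D}$ is a convex monotone map with a t-stable fixed point, then $(\mathcal{E}_t(f),\wedge_f)$ is an inf-semilattice, and, with $C=N^c(f)$, $(r_C(\mathcal{E}_t(f)),\wedge)$ is a convex inf-semilattice in $\mathbb{R}^C$, i.e. $r_C(\mathcal{E}_t(f))$ is a convex subset of $\mathbb{R}^C$ that is closed under the coordinatewise minimum $\wedge$.
   Context: Order on $\mathbb{R}^n$: $x\leq y$ iff $x_i\leq y_i$ for all $i$; $x\wedge y$ is the coordinatewise minimum. A map $f\colon\mathcal{D}\to\mathbb{R}^n$ is monotone if $x\leq y$ implies $f(x)\leq f(y)$, and convex if each coordinate function is convex. An inf-semilattice is a set with an (everywhere defined) associative, commutative, idempotent binary operation. t-stability: for $v\in\mathcal{D}$ let $f'_v(y)=\lim_{\epsilon\downarrow 0}(f(v+\epsilon y)-f(v))/\epsilon$ for $y\in\mathbb{R}^n$. A fixed point $v$ of $f$ is t-stable if every orbit $\{(f'_v)^k(y)\colon k\geq 0\}$, $y\in\mathbb{R}^n$, is bounded from above with respect to $\leq$. $\mathcal{E}(f)$ is the set of fixed points of $f$ and $\mathcal{E}_t(f)$ the set of t-stable fixed points. Operation $\wedge_f$: for $x,y\in\mathcal{E}(f)$, $x\wedge_f y=\lim_{k\to\infty}f^k(x\wedge y)$; under the hypotheses this limit exists (the sequence is decreasing and bounded from below) and lies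 in $\mathcal{E}(f)$. The map $r_C\colon\mathcal{E}(f)\to\mathbb{R}^C$ is the restriction $r_C(x)=x_C=(x_i)_{i\in C}$. Critical nodes: $\partial f(v)$ is the set of real $n\times n$ matrices $M$ with $f(x)-f(v)\geq M(x-v)$ for all $x\in\mathcal{D}$. If $v$ is a t-stable fixed point, all matrices in $\partial f(v)$ are nonnegative and stable (a matrix $P$ is stable if all its orbits $\{P^kx\colon k\ge 0\}$ are bounded). For a nonnegative $n\times n$ matrix $P$, $\mathcal{G}(P)$ is the directed graph on $\{1,\ldots,n\}$ with an arrow from $i$ to $j$ iff $p_{ij}>0$; the classes of $P$ are the equivalence classes of the relation "$i$ has access to $j$ and $j$ has access to $i$" (access = existence of a directed path; each node has access to itself). If $P$ is stable, a class $K$ is critical if $P_{KK}$ has spectral radius $1$, and $N^c(P)$ is the union of the critical classes. One puts $N^c(f)=\bigcup_{P\in\partial f(v)}N^c(P)$ for a t-stable fixed point $v$; this does not depend on the choice of $v$. *)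

theory Defs
  imports "HOL-Analysis.Analysis" "Jordan_Normal_Form.Spectral_Radius"
begin

no_notation vec_index (infixl "$" 100)

text \<open>
  \<open>\<real>\<^sup>n\<close> is \<open>real^'n\<close> with its library order, which is coordinatewise; \<open>inf\<close> is then the
  coordinatewise minimum. A map defined on \<open>D\<close> is a total function whose values outside \<open>D\<close> are
  never used.
\<close>

definition downward :: "'a::ord set \<Rightarrow> bool" where
  "downward D \<longleftrightarrow> (\<forall>x\<in>D. \<forall>y. y \<le> x \<longrightarrow> y \<in> D)"

definition convex_map_on :: "(real^'n) set \<Rightarrow> (real^'n \<Rightarrow> real^'m) \<Rightarrow> bool" where
  "convex_map_on D f \<longleftrightarrow> (\<forall>i. convex_on D (\<lambda>x. f x $ i))"

definition inf_semilattice_on :: "'a set \<Rightarrow> ('a \<Rightarrow> 'a \<Rightarrow> 'a) \<Rightarrow> bool" where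
  "inf_semilattice_on A m \<longleftrightarrow>
     (\<forall>x\<in>A. \<forall>y\<in>A. m x y \<in> A) \<and>
     (\<forall>x\<in>A. \<forall>y\<in>A. \<forall>z\<in>A. m (m x y) z = m x (m y z)) \<and>
     (\<forall>x\<in>A. \<forall>y\<in>A. m x y = m y x) \<and>
     (\<forall>x\<in>A. m x x = x)"

text \<open>
  In \<open>dir_deriv\<close> and \<open>fix_meet\<close> below, \<open>Lim\<close> and \<open>lim\<close> denote the limit only when it exists.
  For a convex map on an open set the one-sided directional derivatives always exist.
\<close>

definition dir_deriv :: "(real^'n \<Rightarrow> real^'n) \<Rightarrow> real^'n \<Rightarrow> real^'n \<Rightarrow> real^'n" where
  "dir_deriv f v y = Lim (at_right 0) (\<lambda>\<epsilon>::real. (f (v + \<epsilon> *\<^sub>R y) - f v) /\<^sub>R \<epsilon>)"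

definition fixpoints :: "(real^'n) set \<Rightarrow> (real^'n \<Rightarrow> real^'n) \<Rightarrow> (real^'n) set" where
  "fixpoints D f = {x \<in> D. f x = x}"

definition t_stable_fixpoints :: "(real^'n) set \<Rightarrow> (real^'n \<Rightarrow> real^'n) \<Rightarrow> (real^'n) set" where
  "t_stable_fixpoints D f =
     {v \<in> fixpoints D f. \<forall>y. bdd_above (range (\<lambda>k. (dir_deriv f v ^^ k) y))}"

definition fix_meet :: "(real^'n \<Rightarrow> real^'n) \<Rightarrow> real^'n \<Rightarrow> real^'n \<Rightarrow> real^'n" where
  "fix_meet f x y = lim (\<lambda>k. (f ^^ k) (inf x y))"

definition subdifferential ::
    "(real^'n) set \<Rightarrow> (real^'n \<Rightarrow> real^'n) \<Rightarrow> real^'n \<Rightarrow> (real^'n^'n) set" where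
  "subdifferential D f v = {M. \<forall>x\<in>D. f x - f v \<ge> M *v (x - v)}"

definition matrix_graph :: "real^'n^'n \<Rightarrow> ('n \<times> 'n) set" where
  "matrix_graph P = {(i, j). P $ i $ j > 0}"

definition matrix_classes :: "real^'n^'n \<Rightarrow> 'n set set" where
  "matrix_classes P =
     UNIV // {(i, j). (i, j) \<in> (matrix_graph P)\<^sup>* \<and> (j, i) \<in> (matrix_graph P)\<^sup>*}"

text \<open>
  The principal submatrix \<open>P\<^sub>K\<^sub>K\<close> as a matrix of size \<open>card K\<close>, along an enumeration
  \<open>from_nat_into K\<close> of \<open>K\<close>, which is a bijection from \<open>{..<card K}\<close> to \<open>K\<close>.
  The choice of enumeration does not affect the spectral radius.
\<close>

definition principal_submatrix :: "real^'n^'n \<Rightarrow> 'n set \<Rightarrow> complex mat" where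
  "principal_submatrix P K =
     mat (card K) (card K)
       (\<lambda>(a, b). complex_of_real (P $ from_nat_into K a $ from_nat_into K b))"

definition critical_classes :: "real^'n^'n \<Rightarrow> 'n set set" where
  "critical_classes P = {K \<in> matrix_classes P. spectral_radius (principal_submatrix P K) = 1}"

definition matrix_critical_nodes :: "real^'n^'n \<Rightarrow> 'n set" where
  "matrix_critical_nodes P = \<Union>(critical_classes P)"

text \<open>
  \<open>critical_nodes D f v\<close> is \<open>N\<^sup>c(f)\<close> computed at the t-stable fixed point \<open>v\<close>; for such \<open>v\<close> the
  matrices in the subdifferential are nonnegative and stable.
\<close>

definition critical_nodes :: "(real^'n) set \<Rightarrow> (real^'n \<Rightarrow> real^'n) \<Rightarrow> real^'n \<Rightarrow> 'n set" where
  "critical_nodes D f v = (\<Union>P\<in>subdifferential D f v. matrix_critical_nodes P)"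

text \<open>
  \<open>\<real>\<^sup>C\<close> is identified, as an ordered vector space, with the vectors of \<open>real^'n\<close> that vanish
  outside \<open>C\<close>; this makes the library notions \<open>convex\<close> and \<open>inf\<close> available on it.
\<close>

definition restrict_coords :: "'n set \<Rightarrow> real^'n \<Rightarrow> real^'n" where
  "restrict_coords C x = (\<chi> i. if i \<in> C then x $ i else 0)"

end

theory Submission
  imports Defs
begin

text \<open>
  Both \<open>u = inf x y\<close> and \<open>u = a x + b y\<close> (a convex combination) satisfy \<open>f u \<le> u\<close> for fixed points
  \<open>x\<close>, \<open>y\<close>, so \<open>f\<^sup>k u\<close> decreases, and the derivative at the t-stable point \<open>v\<close> bounds it from below;
  let \<open>z\<close> be the limit. On the coordinates where \<open>z = u\<close>, the orbits of the derivative at \<open>z\<close> are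
  dominated by those at \<open>x\<close> and \<open>y\<close>; on the others the derivative at \<open>z\<close> is a contraction because
  \<open>f\<^sup>k u\<close> converges to \<open>z\<close>. Hence \<open>z\<close> is t-stable. Finally, for \<open>P\<close> in the subdifferential at \<open>v\<close>,
  \<open>d = u - v\<close> satisfies \<open>P d \<le> d\<close>. The part of \<open>d\<close> that \<open>P\<^sup>k\<close> contracts to zero vanishes on the
  critical classes, and \<open>f\<^sup>k u \<ge> v + P\<^sup>k d\<close>, so \<open>z = u\<close> there.
\<close>

section \<open>Coordinatewise order\<close>

lemma vec_le_iff: "x \<le> y \<longleftrightarrow> (\<forall>i. x $ i \<le> y $ i)" for x y :: "real^'n"
  by (simp add: Finite_Cartesian_Product.less_eq_vec_def)

lemma bdd_above_range_vec_iff: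
  fixes X :: "'b \<Rightarrow> real^'n"
  shows "bdd_above (range X) \<longleftrightarrow> (\<forall>i. bdd_above (range (\<lambda>k. X k $ i)))"
proof
  assume "bdd_above (range X)"
  then obtain b where "\<And>k. X k \<le> b"
    by (auto simp: bdd_above_def)
  then show "\<forall>i. bdd_above (range (\<lambda>k. X k $ i))"
    by (intro allI bdd_aboveI2) (auto simp: vec_le_iff)
next
  assume "\<forall>i. bdd_above (range (\<lambda>k. X k $ i))"
  then have "\<exists>b. \<forall>i k. X k $ i \<le> b i"
    by (intro choice) (auto simp: bdd_above_def)
  then obtain b where "\<And>i k. X k $ i \<le> b i"
    by blast
  then show "bdd_above (range X)"
    by (intro bdd_aboveI2[of _ _ "\<chi> i. b i"]) (auto simp: vec_le_iff)
qed

lemma decreasing_vec_convergent: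
  fixes X :: "nat \<Rightarrow> real^'n"
  assumes "\<And>k. X (Suc k) \<le> X k" and "\<And>k. L \<le> X k"
  shows "\<exists>l. X \<longlonglongrightarrow> l \<and> (\<forall>k. l \<le> X k)"
proof -
  have dec: "decseq (\<lambda>k. X k $ i)" for i
    using assms(1) by (intro decseq_SucI) (auto simp: vec_le_iff)
  have "\<forall>k. L $ i \<le> X k $ i" for i
    using assms(2) by (simp add: vec_le_iff)
  then have "\<exists>l. (\<lambda>k. X k $ i) \<longlonglongrightarrow> l \<and> (\<forall>k. l \<le> X k $ i)" for i
    using decseq_convergent[OF dec] by metis
  then obtain l where "\<And>i. (\<lambda>k. X k $ i) \<longlonglongrightarrow> l i" "\<And>i k. l i \<le> X k $ i"
    by metis
  then show ?thesis
    by (intro exI[of _ "\<chi> i. l i"]) (auto intro!: vec_tendstoI simp: vec_le_iff)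
qed

text \<open>A large multiple of \<open>w\<close> absorbs any discrepancy on the coordinates where
  \<open>w\<close> is positive, so only the zeros of \<open>w\<close> impose a condition. The
  \<open>eventually\<close> form lets finitely many such bounds share one \<open>t\<close>.\<close>

lemma eventually_le_add_scaleR:
  fixes p q w :: "real^'n"
  assumes "0 \<le> w" and "\<And>i. w $ i = 0 \<Longrightarrow> p $ i \<le> q $ i"
  shows "\<forall>\<^sub>F t in at_top. p \<le> q + t *\<^sub>R w"
proof -
  have "\<forall>\<^sub>F t in at_top. p $ i \<le> q $ i + t * w $ i" for i
  proof (cases "w $ i = 0")
    case False
    then have "0 < w $ i"
      using assms(1) by (auto simp: vec_le_iff order.order_iff_strict)
    then show ?thesis
      by (intro eventually_at_top_linorderI[of "(p $ i - q $ i) / w $ i"]) (simp add: field_simps)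
  qed (use assms(2) in simp)
  then show ?thesis
    by (simp add: vec_le_iff eventually_all_finite)
qed

lemma vec_LIMSEQ_ge_const:
  fixes X :: "nat \<Rightarrow> real^'n"
  assumes "X \<longlonglongrightarrow> l" and "\<And>k. c \<le> X k"
  shows "c \<le> l"
  unfolding vec_le_iff
proof
  fix i :: 'n
  show "c $ i \<le> l $ i"
    using assms(2) by (intro LIMSEQ_le_const[OF tendsto_vec_nth[OF assms(1)]])
      (auto simp: vec_le_iff)
qed

section \<open>Critical classes of a nonnegative matrix\<close>

lemma nonneg_matrix_mult_mono:
  fixes P :: "real^'n^'n"
  assumes "\<And>i j. 0 \<le> P $ i $ j"
  shows "mono ((*v) P)"
  using assms
  by (auto simp: mono_def vec_le_iff matrix_vector_mult_def intro!: sum_mono mult_left_mono)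

lemma funpow_matrix_scaleR:
  fixes P :: "real^'n^'n"
  shows "(((*v) P) ^^ k) (c *\<^sub>R x) = c *\<^sub>R (((*v) P) ^^ k) x"
  by (induction k) (auto simp: matrix_vector_mult_scaleR)

lemma funpow_matrix_diff:
  fixes P :: "real^'n^'n"
  shows "(((*v) P) ^^ k) (x - y) = (((*v) P) ^^ k) x - (((*v) P) ^^ k) y"
  by (induction k) (auto simp: matrix_vector_mult_diff_distrib)

text \<open>
  The vector of absolute values of a complex eigenvector for an eigenvalue of modulus \<open>1\<close>.
\<close>
lemma spectral_radius_1_subinvariant:
  fixes P :: "real^'n^'n"
  assumes nonneg: "\<And>i j. 0 \<le> P $ i $ j"
    and "K \<noteq> {}" and radius: "spectral_radius (principal_submatrix P K) = 1"
  obtains r where "0 \<le> r" "r \<noteq> 0" "\<And>i. i \<notin> K \<Longrightarrow> r $ i = 0" "r \<le> P *v r"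
proof -
  let ?n = "card K" and ?A = "principal_submatrix P K" and ?e = "from_nat_into K"
  have bij: "bij_betw ?e {..<?n} K"
    by (simp add: bij_betw_from_nat_into_finite)
  have A: "?A \<in> carrier_mat ?n ?n"
    by (simp add: principal_submatrix_def)
  have "?n > 0"
    using \<open>K \<noteq> {}\<close> by (simp add: card_gt_0_iff)
  then obtain ev where "norm ev = 1" and "ev \<in> spectrum ?A"
    using spectral_radius_mem_max(1)[OF A] radius by auto
  then obtain \<psi> where \<psi>: "\<psi> \<in> carrier_vec ?n" "\<psi> \<noteq> 0\<^sub>v ?n" "?A *\<^sub>v \<psi> = ev \<cdot>\<^sub>v \<psi>"
    using A by (auto simp: spectrum_def eigenvalue_def eigenvector_def)
  \<comment> \<open>\<open>d\<close> sends a node of \<open>K\<close> to its position in the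
    enumeration, so that \<open>psi\<close>, indexed by positions, can be read as a vector indexed
    by nodes.\<close>
  define d where "d = the_inv_into {..<?n} ?e"
  have d: "d i < ?n" "?e (d i) = i" if "i \<in> K" for i
    using that bij the_inv_into_into[of ?e "{..<?n}" i] f_the_inv_into_f_bij_betw[OF bij]
    unfolding d_def bij_betw_def by auto
  have de: "d (?e a) = a" if "a < ?n" for a
    using that bij unfolding d_def bij_betw_def by (simp add: the_inv_into_f_f)
  define r :: "real^'n" where "r = (\<chi> i. if i \<in> K then norm (vec_index \<psi> (d i)) else 0)"
  \<comment> \<open>Take moduli in row \<open>d i\<close> of the eigenvector equation:
    \<open>ev\<close> has modulus 1, the entries of \<open>P\<close> are their own moduli, and
    enlarging the sum from \<open>K\<close> to all nodes only adds nonnegative terms.\<close>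
  have on_K: "r $ i \<le> (P *v r) $ i" if "i \<in> K" for i
  proof -
    have "vec_index (?A *\<^sub>v \<psi>) (d i)
        = (\<Sum>a<?n. complex_of_real (P $ i $ ?e a) * vec_index \<psi> a)"
      using \<psi>(1) A d[OF that]
      by (auto simp: principal_submatrix_def scalar_prod_def atLeast0LessThan intro!: sum.cong)
    then have "ev * vec_index \<psi> (d i)
        = (\<Sum>a<?n. complex_of_real (P $ i $ ?e a) * vec_index \<psi> a)"
      using \<psi>(1,3) d[OF that] by simp
    then have "norm (vec_index \<psi> (d i))
        = norm (\<Sum>a<?n. complex_of_real (P $ i $ ?e a) * vec_index \<psi> a)"
      using \<open>norm ev = 1\<close> by (metis mult_1 norm_mult)
    also have "\<dots> \<le> (\<Sum>a<?n. norm (complex_of_real (P $ i $ ?e a) * vec_index \<psi> a))"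
      by (rule norm_sum)
    also have "\<dots> = (\<Sum>a<?n. P $ i $ ?e a * norm (vec_index \<psi> a))"
      using nonneg by (simp add: norm_mult)
    also have "\<dots> = (\<Sum>a<?n. P $ i $ ?e a * norm (vec_index \<psi> (d (?e a))))"
      by (simp add: de)
    also have "\<dots> = (\<Sum>j\<in>K. P $ i $ j * norm (vec_index \<psi> (d j)))"
      by (rule sum.reindex_bij_betw[OF bij])
    also have "\<dots> = (\<Sum>j\<in>K. P $ i $ j * r $ j)"
      by (simp add: r_def)
    also have "\<dots> \<le> (\<Sum>j\<in>UNIV. P $ i $ j * r $ j)"
      using nonneg by (intro sum_mono2) (auto simp: r_def)
    finally show ?thesis
      using that by (simp add: r_def matrix_vector_mult_def)
  qed
  have "0 \<le> r"
    by (simp add: r_def vec_le_iff)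
  then have "0 \<le> P *v r"
    using monoD[OF nonneg_matrix_mult_mono[OF nonneg]] by fastforce
  have off_K: "r $ i = 0" if "i \<notin> K" for i
    using that by (simp add: r_def)
  obtain a where "a < ?n" "vec_index \<psi> a \<noteq> 0"
    using \<psi>(1,2) by (metis eq_vecI carrier_vecD index_zero_vec)
  then have "r $ ?e a \<noteq> 0"
    using bij de by (auto simp: r_def bij_betw_def)
  then have "r \<noteq> 0"
    by auto
  have "r $ i \<le> (P *v r) $ i" for i
    using on_K off_K \<open>0 \<le> P *v r\<close> by (cases "i \<in> K") (simp_all add: vec_le_iff)
  then show thesis
    using that \<open>0 \<le> r\<close> \<open>r \<noteq> 0\<close> off_K by (simp add: vec_le_iff)
qed

text \<open>Suppose \<open>e $ i > 0\<close>. Since \<open>P *v e <= e\<close>, positivity travels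
  backwards along arrows, hence to the whole critical class \<open>K\<close> of \<open>i\<close>. A
  multiple \<open>t e\<close> then dominates the nonzero subinvariant vector \<open>r\<close>
  supported in \<open>K\<close>, and \<open>r <= P^k r <= t P^k e\<close> tends to 0, which is
  impossible.\<close>

lemma contracted_vanishes_on_critical_nodes:
  fixes P :: "real^'n^'n"
  assumes nonneg: "\<And>i j. 0 \<le> P $ i $ j" and "0 \<le> e" and "P *v e \<le> e"
    and lim: "(\<lambda>k. (((*v) P) ^^ k) e) \<longlonglongrightarrow> 0"
    and "i \<in> matrix_critical_nodes P"
  shows "e $ i = 0"
proof (rule ccontr)
  assume "e $ i \<noteq> 0"
  let ?R = "{(i, j). (i, j) \<in> (matrix_graph P)\<^sup>* \<and> (j, i) \<in> (matrix_graph P)\<^sup>*}"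
  obtain K where K: "i \<in> K" "K \<in> UNIV // ?R"
    and radius: "spectral_radius (principal_submatrix P K) = 1"
    using assms(5) by (auto simp: matrix_critical_nodes_def critical_classes_def matrix_classes_def)
  have access: "e $ j > 0" if "(j, i) \<in> (matrix_graph P)\<^sup>*" for j
    using that
  proof (induction rule: converse_rtrancl_induct)
    case base
    then show ?case
      using \<open>e $ i \<noteq> 0\<close> \<open>0 \<le> e\<close> by (simp add: vec_le_iff order_less_le)
  next
    case (step j l)
    then have "0 < P $ j $ l * e $ l"
      by (simp add: matrix_graph_def)
    also have "\<dots> \<le> (P *v e) $ j"
      unfolding matrix_vector_mult_def vec_lambda_beta
      using nonneg \<open>0 \<le> e\<close> by (intro member_le_sum) (auto simp: vec_le_iff)
    also have "\<dots> \<le> e $ j"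
      using \<open>P *v e \<le> e\<close> by (simp add: vec_le_iff)
    finally show ?case .
  qed
  have pos: "e $ j > 0" if "j \<in> K" for j
  proof -
    obtain l where l: "K = ?R `` {l}"
      using K(2) by (auto elim: quotientE)
    then have "(j, l) \<in> (matrix_graph P)\<^sup>*" "(l, i) \<in> (matrix_graph P)\<^sup>*"
      using K(1) that by auto
    then show ?thesis
      using access by (metis rtrancl_trans)
  qed
  obtain r where r: "0 \<le> r" "r \<noteq> 0" "\<And>i. i \<notin> K \<Longrightarrow> r $ i = 0" "r \<le> P *v r"
    using spectral_radius_1_subinvariant[OF nonneg _ radius] K(1) by blast
  have "r $ j \<le> 0" if "e $ j = 0" for j
    using that pos[of j] r(3)[of j] by (cases "j \<in> K") simp_all
  then have "\<forall>\<^sub>F t in at_top. r \<le> 0 + t *\<^sub>R e"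
    by (intro eventually_le_add_scaleR \<open>0 \<le> e\<close>) simp
  then obtain t where t: "r \<le> t *\<^sub>R e"
    by (auto dest: eventually_happens)
  have mono: "mono ((*v) P)"
    by (rule nonneg_matrix_mult_mono[OF nonneg])
  have "r \<le> (((*v) P) ^^ k) r" for k
  proof (induction k)
    case (Suc k)
    show ?case
      using r(4) monoD[OF mono Suc] by simp
  qed simp
  then have "r \<le> t *\<^sub>R (((*v) P) ^^ k) e" for k
    using funpow_mono[OF mono t, of k] by (metis funpow_matrix_scaleR order_trans)
  moreover have "(\<lambda>k. t *\<^sub>R (((*v) P) ^^ k) e) \<longlonglongrightarrow> t *\<^sub>R 0"
    by (intro tendsto_intros lim)
  ultimately have "r \<le> 0"
    using vec_LIMSEQ_ge_const[of _ "t *\<^sub>R 0" r] by simp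
  then show False
    using r(1,2) order.antisym by blast
qed

section \<open>Directional derivatives\<close>

locale convex_monotone_map =
  fixes D :: "(real^'n) set" and f :: "real^'n \<Rightarrow> real^'n"
  assumes open_D: "open D" and convex_D: "convex D" and downward_D: "downward D"
    and maps: "f ` D \<subseteq> D" and convex_f: "convex_map_on D f" and mono_f: "mono_on D f"
begin

lemma below_mem: "x \<in> D \<Longrightarrow> y \<le> x \<Longrightarrow> y \<in> D"
  using downward_D by (auto simp: downward_def)

lemma convex_combination:
  assumes "x \<in> D" "y \<in> D" "0 \<le> a" "0 \<le> b" "a + b = (1::real)"
  shows "a *\<^sub>R x + b *\<^sub>R y \<in> D" "f (a *\<^sub>R x + b *\<^sub>R y) \<le> a *\<^sub>R f x + b *\<^sub>R f y"
proof -
  show "a *\<^sub>R x + b *\<^sub>R y \<in> D"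
    using assms convex_D by (simp add: convexD)
  have "f (a *\<^sub>R x + b *\<^sub>R y) $ i \<le> a * f x $ i + b * f y $ i" for i
    using convex_f assms by (auto simp: convex_map_on_def convex_on_def)
  then show "f (a *\<^sub>R x + b *\<^sub>R y) \<le> a *\<^sub>R f x + b *\<^sub>R f y"
    by (simp add: vec_le_iff)
qed

lemma eventually_mem:
  assumes "v \<in> D"
  shows "\<forall>\<^sub>F \<epsilon> in at_right (0::real). v + \<epsilon> *\<^sub>R y \<in> D"
proof -
  have "((\<lambda>\<epsilon>. v + \<epsilon> *\<^sub>R y) \<longlongrightarrow> v + 0 *\<^sub>R y) (at_right (0::real))"
    by (intro tendsto_intros)
  then show ?thesis
    using open_D assms by (auto dest: topological_tendstoD)
qed

section \<open>Difference quotients and existence of the one-sided derivative\<close>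

lemma difference_quotient_mono:
  assumes "v \<in> D" "v + t *\<^sub>R y \<in> D" "0 < s" "s \<le> t"
  shows "(f (v + s *\<^sub>R y) - f v) /\<^sub>R s \<le> (f (v + t *\<^sub>R y) - f v) /\<^sub>R t"
proof -
  have "v + s *\<^sub>R y = (1 - s / t) *\<^sub>R v + (s / t) *\<^sub>R (v + t *\<^sub>R y)"
    using assms by (simp add: algebra_simps)
  then have "f (v + s *\<^sub>R y) \<le> (1 - s / t) *\<^sub>R f v + (s / t) *\<^sub>R f (v + t *\<^sub>R y)"
    using convex_combination(2)[OF assms(1,2), of "1 - s / t" "s / t"] assms(3,4) by simp
  then have "f (v + s *\<^sub>R y) $ i - f v $ i \<le> (s / t) * (f (v + t *\<^sub>R y) $ i - f v $ i)" for i
    by (simp add: vec_le_iff algebra_simps)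
  then show ?thesis
    using assms(3,4) by (auto simp: vec_le_iff field_simps)
qed

text \<open>The point \<open>v\<close> is a convex combination of \<open>v + s y\<close> and
  \<open>v - r y\<close>, with weights proportional to \<open>r\<close> and \<open>s\<close>. One
  backward quotient thus bounds all forward quotients from below, which keeps their infimum
  finite.\<close>

lemma difference_quotient_ge:
  assumes "v \<in> D" "v + s *\<^sub>R y \<in> D" "v - r *\<^sub>R y \<in> D" "0 < s" "0 < r"
  shows "(f v - f (v - r *\<^sub>R y)) /\<^sub>R r \<le> (f (v + s *\<^sub>R y) - f v) /\<^sub>R s"
proof -
  let ?a = "r / (r + s)" and ?b = "s / (r + s)"
  have sum: "?a + ?b = 1"
    using assms(4,5) by (simp add: add_divide_distrib[symmetric])
  have "?a *\<^sub>R (v + s *\<^sub>R y) + ?b *\<^sub>R (v - r *\<^sub>R y) = (?a + ?b) *\<^sub>R v"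
    by (simp add: algebra_simps)
  then have "f v \<le> ?a *\<^sub>R f (v + s *\<^sub>R y) + ?b *\<^sub>R f (v - r *\<^sub>R y)"
    using convex_combination(2)[OF assms(2,3) _ _ sum] assms(4,5) sum by simp
  then have "f v $ i \<le> (r * f (v + s *\<^sub>R y) $ i + s * f (v - r *\<^sub>R y) $ i) / (r + s)" for i
    by (simp add: vec_le_iff add_divide_distrib)
  then have "(r + s) * f v $ i \<le> r * f (v + s *\<^sub>R y) $ i + s * f (v - r *\<^sub>R y) $ i" for i
    using assms(4,5) by (simp add: pos_le_divide_eq mult.commute)
  then have "s * (f v $ i - f (v - r *\<^sub>R y) $ i) \<le> r * (f (v + s *\<^sub>R y) $ i - f v $ i)" for i
    by (simp add: algebra_simps)
  then show ?thesis
    using assms(4,5) by (auto simp: vec_le_iff field_simps)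
qed

text \<open>The quotients decrease as the step shrinks and are bounded below, so in each coordinate
  they converge to their infimum.\<close>

lemma has_dir_deriv:
  assumes "v \<in> D"
  shows "((\<lambda>\<epsilon>. (f (v + \<epsilon> *\<^sub>R y) - f v) /\<^sub>R \<epsilon>) \<longlongrightarrow> dir_deriv f v y) (at_right 0)"
proof -
  define q where "q \<epsilon> = (f (v + \<epsilon> *\<^sub>R y) - f v) /\<^sub>R \<epsilon>" for \<epsilon>
  obtain s where s: "0 < s" "\<And>\<epsilon>. 0 < \<epsilon> \<Longrightarrow> \<epsilon> < s \<Longrightarrow> v + \<epsilon> *\<^sub>R y \<in> D"
    using eventually_mem[OF assms, of y] by (auto simp: eventually_at_right_field)
  obtain s' where s': "0 < s'" "\<And>\<epsilon>. 0 < \<epsilon> \<Longrightarrow> \<epsilon> < s' \<Longrightarrow> v + \<epsilon> *\<^sub>R (- y) \<in> D"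
    using eventually_mem[OF assms, of "- y"] by (auto simp: eventually_at_right_field)
  \<comment> \<open>Halving turns the strict bounds on the step into the closed range
    \<open>0 < eps <= r\<close>, and keeps the reflected point \<open>v - r y\<close> in
    \<open>D\<close>.\<close>
  define r where "r = min s s' / 2"
  have r: "0 < r" "v - r *\<^sub>R y \<in> D" "\<And>\<epsilon>. 0 < \<epsilon> \<Longrightarrow> \<epsilon> \<le> r \<Longrightarrow> v + \<epsilon> *\<^sub>R y \<in> D"
    using s s'(1) s'(2)[of r] by (auto simp: r_def)
  define l where "l i = (INF \<epsilon>\<in>{0<..r}. q \<epsilon> $ i)" for i
  have bdd: "bdd_below ((\<lambda>\<epsilon>. q \<epsilon> $ i) ` {0<..r})" for i
  proof (rule bdd_belowI2)
    fix \<epsilon> assume "\<epsilon> \<in> {0<..r}"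
    then show "((f v - f (v - r *\<^sub>R y)) /\<^sub>R r) $ i \<le> q \<epsilon> $ i"
      using difference_quotient_ge[OF assms r(3) r(2), of \<epsilon>] r(1)
      unfolding q_def vec_le_iff by auto
  qed
  have "((\<lambda>\<epsilon>. q \<epsilon> $ i) \<longlongrightarrow> l i) (at_right 0)" for i
  proof (rule order_tendstoI)
    fix c assume "c < l i"
    then have "c < q \<epsilon> $ i" if "0 < \<epsilon>" "\<epsilon> < r" for \<epsilon>
      using cINF_lower[OF bdd, of \<epsilon> i] that by (auto simp: l_def)
    then show "\<forall>\<^sub>F \<epsilon> in at_right 0. c < q \<epsilon> $ i"
      using r(1) by (auto simp: eventually_at_right_field)
  next
    fix c assume "l i < c"
    then obtain t where t: "0 < t" "t \<le> r" "q t $ i < c"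
      using cINF_less_iff[OF _ bdd] r(1) by (auto simp: l_def)
    then have "q \<epsilon> $ i < c" if "0 < \<epsilon>" "\<epsilon> < t" for \<epsilon>
      using difference_quotient_mono[OF assms r(3) that(1), of t] that
      unfolding q_def vec_le_iff by (meson le_less_trans less_imp_le)
    then show "\<forall>\<^sub>F \<epsilon> in at_right 0. q \<epsilon> $ i < c"
      using t(1) by (auto simp: eventually_at_right_field)
  qed
  then have "(q \<longlongrightarrow> (\<chi> i. l i)) (at_right 0)"
    by (intro vec_tendstoI) simp
  then have "(q \<longlongrightarrow> Lim (at_right 0) q) (at_right 0)"
    by (simp add: tendsto_Lim)
  then show ?thesis
    by (simp add: q_def[abs_def] dir_deriv_def)
qed

lemma has_dir_deriv_nth:
  assumes "v \<in> D"
  shows "((\<lambda>\<epsilon>. (f (v + \<epsilon> *\<^sub>R y) $ i - f v $ i) / \<epsilon>) \<longlongrightarrow> dir_deriv f v y $ i) (at_right 0)"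
  using tendsto_vec_nth[OF has_dir_deriv[OF assms], of y i] by (simp add: divide_inverse_commute)

text \<open>The increment is the difference quotient at step 1, and smaller steps give smaller
  quotients.\<close>

lemma dir_deriv_le_increment:
  assumes "v \<in> D" "v + y \<in> D"
  shows "dir_deriv f v y \<le> f (v + y) - f v"
  unfolding vec_le_iff
proof
  fix i
  have "\<forall>\<^sub>F \<epsilon> in at_right 0. ((f (v + \<epsilon> *\<^sub>R y) - f v) /\<^sub>R \<epsilon>) $ i \<le> (f (v + y) - f v) $ i"
    using difference_quotient_mono[OF assms(1), of 1 y] assms(2)
    by (auto simp: eventually_at_right_field vec_le_iff intro!: exI[of _ 1])
  then show "dir_deriv f v y $ i \<le> (f (v + y) - f v) $ i"
    by (intro tendsto_upperbound[OF tendsto_vec_nth[OF has_dir_deriv[OF assms(1)]]]) auto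
qed

text \<open>
  This single comparison gives convexity of the directional derivative at a point (for
  \<open>x = y = z\<close>) as well as its dependence on the point.
\<close>
lemma dir_deriv_compare:
  assumes "x \<in> D" "y \<in> D" "z \<in> D" "0 \<le> a" "0 \<le> b" "a + b = (1::real)"
    and "z \<le> a *\<^sub>R x + b *\<^sub>R y" and "f z $ i = a * f x $ i + b * f y $ i"
  shows "dir_deriv f z (a *\<^sub>R p + b *\<^sub>R q) $ i \<le> a * dir_deriv f x p $ i + b * dir_deriv f y q $ i"
proof (rule tendsto_le)
  show "((\<lambda>\<epsilon>. (f (z + \<epsilon> *\<^sub>R (a *\<^sub>R p + b *\<^sub>R q)) $ i - f z $ i) / \<epsilon>)
      \<longlongrightarrow> dir_deriv f z (a *\<^sub>R p + b *\<^sub>R q) $ i) (at_right 0)"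
    by (rule has_dir_deriv_nth[OF assms(3)])
  show "((\<lambda>\<epsilon>. a * ((f (x + \<epsilon> *\<^sub>R p) $ i - f x $ i) / \<epsilon>) + b * ((f (y + \<epsilon> *\<^sub>R q) $ i - f y $ i) / \<epsilon>))
      \<longlongrightarrow> a * dir_deriv f x p $ i + b * dir_deriv f y q $ i) (at_right 0)"
    by (intro tendsto_add tendsto_mult_left has_dir_deriv_nth assms(1,2))
  have "\<forall>\<^sub>F \<epsilon> in at_right (0::real). 0 < \<epsilon>"
    by (auto simp: eventually_at_right_field intro!: exI[of _ 1])
  with eventually_mem[OF assms(1), of p] eventually_mem[OF assms(2), of q]
  show "\<forall>\<^sub>F \<epsilon> in at_right 0. (f (z + \<epsilon> *\<^sub>R (a *\<^sub>R p + b *\<^sub>R q)) $ i - f z $ i) / \<epsilon>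
      \<le> a * ((f (x + \<epsilon> *\<^sub>R p) $ i - f x $ i) / \<epsilon>) + b * ((f (y + \<epsilon> *\<^sub>R q) $ i - f y $ i) / \<epsilon>)"
  proof eventually_elim
    case (elim \<epsilon>)
    let ?u = "a *\<^sub>R (x + \<epsilon> *\<^sub>R p) + b *\<^sub>R (y + \<epsilon> *\<^sub>R q)" and ?z = "z + \<epsilon> *\<^sub>R (a *\<^sub>R p + b *\<^sub>R q)"
    \<comment> \<open>Monotonicity passes from \<open>?z\<close> to \<open>?u\<close>, and convexity
      splits \<open>?u\<close> into the perturbed points at \<open>x\<close> and \<open>y\<close>.
      The base values cancel only in coordinate \<open>i\<close>, where \<open>f z\<close> is the
      same combination of \<open>f x\<close> and \<open>f y\<close>.\<close>
    have "?z \<le> ?u"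
      using assms(7) by (simp add: vec_le_iff algebra_simps)
    moreover have "?u \<in> D"
      using elim assms by (intro convex_combination(1)) auto
    ultimately have "f ?z \<le> f ?u"
      using mono_onD[OF mono_f] below_mem by simp
    also have "f ?u \<le> a *\<^sub>R f (x + \<epsilon> *\<^sub>R p) + b *\<^sub>R f (y + \<epsilon> *\<^sub>R q)"
      using elim assms by (intro convex_combination(2)) auto
    finally have "f ?z $ i \<le> a * f (x + \<epsilon> *\<^sub>R p) $ i + b * f (y + \<epsilon> *\<^sub>R q) $ i"
      by (simp add: vec_le_iff)
    then have "(f ?z $ i - f z $ i) / \<epsilon>
        \<le> (a * (f (x + \<epsilon> *\<^sub>R p) $ i - f x $ i) + b * (f (y + \<epsilon> *\<^sub>R q) $ i - f y $ i)) / \<epsilon>"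
      using elim assms(8) by (intro divide_right_mono) (auto simp: algebra_simps)
    then show ?case
      by (simp add: add_divide_distrib)
  qed
qed simp

section \<open>Monotonicity and sublinearity of the directional derivative and its iterates\<close>

lemma dir_deriv_mono:
  assumes "v \<in> D"
  shows "mono (dir_deriv f v)"
proof (intro monoI)
  fix p q :: "real^'n" assume "p \<le> q"
  have "dir_deriv f v p $ i \<le> dir_deriv f v q $ i" for i
  proof (rule tendsto_le[OF _ has_dir_deriv_nth[OF assms] has_dir_deriv_nth[OF assms]])
    have "\<forall>\<^sub>F \<epsilon> in at_right (0::real). 0 < \<epsilon>"
      by (auto simp: eventually_at_right_field intro!: exI[of _ 1])
    with eventually_mem[OF assms, of p] eventually_mem[OF assms, of q]
    show "\<forall>\<^sub>F \<epsilon> in at_right 0. (f (v + \<epsilon> *\<^sub>R p) $ i - f v $ i) / \<epsilon>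
        \<le> (f (v + \<epsilon> *\<^sub>R q) $ i - f v $ i) / \<epsilon>"
    proof eventually_elim
      case (elim \<epsilon>)
      then have "v + \<epsilon> *\<^sub>R p \<le> v + \<epsilon> *\<^sub>R q"
        using \<open>p \<le> q\<close> by (simp add: vec_le_iff)
      then have "f (v + \<epsilon> *\<^sub>R p) \<le> f (v + \<epsilon> *\<^sub>R q)"
        using mono_onD[OF mono_f] elim by simp
      then show ?case
        using elim by (auto simp: vec_le_iff intro!: divide_right_mono)
    qed
  qed simp
  then show "dir_deriv f v p \<le> dir_deriv f v q"
    by (simp add: vec_le_iff)
qed

lemma dir_deriv_scaleR:
  assumes "v \<in> D" "0 \<le> t"
  shows "dir_deriv f v (t *\<^sub>R y) = t *\<^sub>R dir_deriv f v y"
proof (cases "t = 0")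
  case True
  have "dir_deriv f v 0 = 0"
    using tendsto_Lim[of "at_right (0::real)" "\<lambda>_. 0 :: real^'n" 0] by (simp add: dir_deriv_def)
  with True show ?thesis
    by simp
next
  case False
  with assms(2) have "0 < t"
    by simp
  have "filterlim (\<lambda>\<epsilon>. t * \<epsilon>) (at_right 0) (at_right 0)"
    using \<open>0 < t\<close> by (intro filterlim_times_pos[OF filterlim_ident]) auto
  from filterlim_compose[OF has_dir_deriv[OF assms(1), of y] this]
  have "((\<lambda>\<epsilon>. t *\<^sub>R ((f (v + (t * \<epsilon>) *\<^sub>R y) - f v) /\<^sub>R (t * \<epsilon>))) \<longlongrightarrow> t *\<^sub>R dir_deriv f v y)
      (at_right 0)"
    by (intro tendsto_scaleR tendsto_const)
  moreover have "t *\<^sub>R (x /\<^sub>R (t * \<epsilon>)) = x /\<^sub>R \<epsilon>" for x :: "real^'n" and \<epsilon>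
    using \<open>0 < t\<close> by (simp add: field_simps)
  moreover have "(t * \<epsilon>) *\<^sub>R y = \<epsilon> *\<^sub>R (t *\<^sub>R y)" for \<epsilon>
    by simp
  ultimately have "((\<lambda>\<epsilon>. (f (v + \<epsilon> *\<^sub>R (t *\<^sub>R y)) - f v) /\<^sub>R \<epsilon>) \<longlongrightarrow> t *\<^sub>R dir_deriv f v y) (at_right 0)"
    by (simp only:)
  then show ?thesis
    using has_dir_deriv[OF assms(1)] tendsto_unique trivial_limit_at_right_real by blast
qed

text \<open>Convexity and positive homogeneity combine, \<open>p + q\<close> being the midpoint of
  \<open>2 p\<close> and \<open>2 q\<close>.\<close>

lemma dir_deriv_add_le:
  assumes "v \<in> D"
  shows "dir_deriv f v (p + q) \<le> dir_deriv f v p + dir_deriv f v q"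
  unfolding vec_le_iff
proof
  fix i
  have "(1/2) *\<^sub>R v + (1/2) *\<^sub>R v = v"
    by (simp flip: scaleR_left_distrib)
  then have "dir_deriv f v ((1/2) *\<^sub>R (2 *\<^sub>R p) + (1/2) *\<^sub>R (2 *\<^sub>R q)) $ i
      \<le> 1/2 * dir_deriv f v (2 *\<^sub>R p) $ i + 1/2 * dir_deriv f v (2 *\<^sub>R q) $ i"
    by (intro dir_deriv_compare assms) auto
  then show "dir_deriv f v (p + q) $ i \<le> (dir_deriv f v p + dir_deriv f v q) $ i"
    by (simp add: dir_deriv_scaleR[OF assms])
qed

lemma funpow_dir_deriv_add_le:
  assumes "v \<in> D"
  shows "(dir_deriv f v ^^ k) (p + q) \<le> (dir_deriv f v ^^ k) p + (dir_deriv f v ^^ k) q"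
proof (induction k)
  case (Suc k)
  show ?case
    using order_trans[OF monoD[OF dir_deriv_mono[OF assms] Suc] dir_deriv_add_le[OF assms]] by simp
qed simp

lemma funpow_dir_deriv_scaleR:
  assumes "v \<in> D" "0 \<le> t"
  shows "(dir_deriv f v ^^ k) (t *\<^sub>R y) = t *\<^sub>R (dir_deriv f v ^^ k) y"
  by (induction k) (auto simp: dir_deriv_scaleR[OF assms])

text \<open>Subadditivity applied to \<open>y + (- y) = 0\<close>. As t-stability bounds orbits only
  from above, this is how it yields lower bounds: the orbit of \<open>- y\<close> controls that of
  \<open>y\<close> from below.\<close>

lemma minus_funpow_dir_deriv_le:
  assumes "v \<in> D"
  shows "- (dir_deriv f v ^^ k) (- y) \<le> (dir_deriv f v ^^ k) y"
proof -
  have "(dir_deriv f v ^^ k) 0 = 0"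
    using funpow_dir_deriv_scaleR[OF assms, of 0 k 0] by simp
  then have "0 \<le> (dir_deriv f v ^^ k) y + (dir_deriv f v ^^ k) (- y)"
    using funpow_dir_deriv_add_le[OF assms, of k y "- y"] by simp
  then have "0 \<le> (dir_deriv f v ^^ k) y $ i + (dir_deriv f v ^^ k) (- y) $ i" for i
    by (simp add: vec_le_iff)
  then have "- (dir_deriv f v ^^ k) (- y) $ i \<le> (dir_deriv f v ^^ k) y $ i" for i
    by (smt (verit))
  then show ?thesis
    by (simp add: vec_le_iff)
qed

section \<open>Stable fixed points\<close>

lemma fixpointsD: "v \<in> fixpoints D f \<Longrightarrow> v \<in> D" "v \<in> fixpoints D f \<Longrightarrow> f v = v"
  by (simp_all add: fixpoints_def)

lemma t_stable_fixpointsD: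
  assumes "v \<in> t_stable_fixpoints D f"
  shows "v \<in> fixpoints D f" "v \<in> D" "f v = v"
    and "bdd_above (range (\<lambda>k. (dir_deriv f v ^^ k) y $ i))"
  using assms by (auto simp: t_stable_fixpoints_def fixpoints_def bdd_above_range_vec_iff)

section \<open>Orbits of supersolutions, that is, of points with \<open>f u <= u\<close>\<close>

lemma supersolution_orbit:
  assumes "u \<in> D" "f u \<le> u"
  shows "(f ^^ k) u \<in> D" "(f ^^ Suc k) u \<le> (f ^^ k) u"
proof -
  show mem: "(f ^^ k) u \<in> D" for k
    using assms(1) maps by (induction k) auto
  show "(f ^^ Suc k) u \<le> (f ^^ k) u"
  proof (induction k)
    case (Suc k)
    then show ?case
      using mono_onD[OF mono_f mem[of "Suc k"] mem[of k]] by simp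
  qed (use assms in simp)
qed

text \<open>Stated for an arbitrary monotone minorant \<open>g\<close> of the increment at a fixed
  point \<open>v\<close>, so that it serves both for the directional derivative and for a matrix of
  the subdifferential.\<close>

lemma funpow_increment_ge:
  assumes "mono g" "\<And>y. v + y \<in> D \<Longrightarrow> g y \<le> f (v + y) - v" "u \<in> D"
  shows "(g ^^ k) (u - v) \<le> (f ^^ k) u - v"
proof (induction k)
  case (Suc k)
  have "(f ^^ k) u \<in> D"
    using assms(3) maps by (induction k) auto
  then have "g ((f ^^ k) u - v) \<le> f ((f ^^ k) u) - v"
    using assms(2)[of "(f ^^ k) u - v"] by simp
  then show ?case
    using order_trans[OF monoD[OF assms(1) Suc]] by simp
qed simp

text \<open>The derivative orbit of \<open>u - v\<close> is bounded below and lies below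
  \<open>f^k u - v\<close>, so the decreasing sequence \<open>f^k u\<close> converges. Its limit is
  below \<open>u\<close>, hence in the downward set \<open>D\<close>, where \<open>f\<close> is
  continuous because it is convex and \<open>D\<close> is open; so the limit is fixed.\<close>

lemma supersolution_limit:
  assumes "u \<in> D" "f u \<le> u" and v: "v \<in> t_stable_fixpoints D f"
  obtains z where "(\<lambda>k. (f ^^ k) u) \<longlonglongrightarrow> z" "z \<le> u" "z \<in> fixpoints D f"
proof -
  note v' = t_stable_fixpointsD[OF v]
  have "\<exists>c. \<forall>i k. (dir_deriv f v ^^ k) (- (u - v)) $ i \<le> c i"
    using v'(4) by (intro choice) (auto simp: bdd_above_def)
  then obtain c where c: "\<And>i k. (dir_deriv f v ^^ k) (- (u - v)) $ i \<le> c i"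
    by blast
  have "v - (\<chi> i. c i) \<le> (f ^^ k) u" for k
  proof -
    have "(dir_deriv f v ^^ k) (u - v) \<le> (f ^^ k) u - v"
      using dir_deriv_le_increment[OF v'(2)] v'(3)
      by (intro funpow_increment_ge dir_deriv_mono v'(2) assms(1)) simp
    then have "- (dir_deriv f v ^^ k) (- (u - v)) $ i \<le> (f ^^ k) u $ i - v $ i" for i
      using minus_funpow_dir_deriv_le[OF v'(2), of k "u - v"]
      by (fastforce simp: vec_le_iff intro: order_trans)
    then have "v $ i - c i \<le> (f ^^ k) u $ i" for i
      using c[of k i] by (smt (verit))
    then show ?thesis
      by (simp add: vec_le_iff)
  qed
  then obtain z where z: "(\<lambda>k. (f ^^ k) u) \<longlonglongrightarrow> z" "\<And>k. z \<le> (f ^^ k) u"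
    using decreasing_vec_convergent[of "\<lambda>k. (f ^^ k) u"] supersolution_orbit(2)[OF assms(1,2)]
    by metis
  have "z \<le> u"
    using z(2)[of 0] by simp
  then have "z \<in> D"
    using below_mem assms(1) by blast
  have "(\<lambda>k. (f ^^ Suc k) u) \<longlonglongrightarrow> f z"
  proof (rule vec_tendstoI)
    fix i
    have "continuous_on D (\<lambda>x. f x $ i)"
      using convex_f open_D by (auto simp: convex_map_on_def intro: convex_on_continuous)
    then have "isCont (\<lambda>x. f x $ i) z"
      using open_D \<open>z \<in> D\<close> by (simp add: continuous_on_eq_continuous_at)
    then show "(\<lambda>k. (f ^^ Suc k) u $ i) \<longlonglongrightarrow> f z $ i"
      using isCont_tendsto_compose[OF _ z(1)] by simp
  qed
  with LIMSEQ_Suc[OF z(1)] have "f z = z"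
    using LIMSEQ_unique by blast
  with \<open>z \<in> D\<close> show thesis
    using that z(1) \<open>z \<le> u\<close> by (simp add: fixpoints_def)
qed

text \<open>
  Write \<open>w = u - z\<close>. As \<open>dir_deriv f z w \<le> w\<close>, adding a multiple of \<open>w\<close> does not increase the
  directional derivative at \<open>z\<close> on the coordinates where \<open>w\<close> vanishes; so there it depends only on
  these coordinates, and the comparison at \<open>x\<close> and \<open>y\<close> can be iterated.
\<close>
lemma funpow_dir_deriv_compare:
  assumes "x \<in> fixpoints D f" "y \<in> fixpoints D f" "z \<in> fixpoints D f"
    and ab: "0 \<le> a" "0 \<le> b" "a + b = (1::real)"
    and u: "u = a *\<^sub>R x + b *\<^sub>R y" and "z \<le> u" and "z $ i = u $ i"
  shows "(dir_deriv f z ^^ k) p $ i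
    \<le> a * (dir_deriv f x ^^ k) p $ i + b * (dir_deriv f y ^^ k) p $ i"
  using assms(9)
proof (induction k arbitrary: i)
  case 0
  show ?case
    using ab(3) by (simp flip: distrib_right)
next
  case (Suc k)
  note D = fixpointsD(1)[OF assms(1)] fixpointsD(1)[OF assms(2)] fixpointsD(1)[OF assms(3)]
  note fix_eq = fixpointsD(2)[OF assms(1)] fixpointsD(2)[OF assms(2)] fixpointsD(2)[OF assms(3)]
  let ?g = "dir_deriv f z" and ?p = "(dir_deriv f x ^^ k) p" and ?q = "(dir_deriv f y ^^ k) p"
  define w where "w = u - z"
  have "u \<in> D" "f u \<le> u"
    using convex_combination[OF D(1,2) ab] fix_eq by (simp_all add: u)
  then have gw: "?g w \<le> w"
    using dir_deriv_le_increment[OF D(3), of w] fix_eq by (auto simp: w_def vec_le_iff intro: order_trans)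
  have "0 \<le> w"
    using \<open>z \<le> u\<close> by (simp add: w_def vec_le_iff)
  moreover have "(?g ^^ k) p $ j \<le> (a *\<^sub>R ?p + b *\<^sub>R ?q) $ j" if "w $ j = 0" for j
    using Suc.IH[of j] that by (simp add: w_def)
  ultimately have "\<forall>\<^sub>F t in at_top. (?g ^^ k) p \<le> (a *\<^sub>R ?p + b *\<^sub>R ?q) + t *\<^sub>R w"
    by (rule eventually_le_add_scaleR)
  then obtain t where t: "0 \<le> t" "(?g ^^ k) p \<le> (a *\<^sub>R ?p + b *\<^sub>R ?q) + t *\<^sub>R w"
    using eventually_conj[OF eventually_ge_at_top[of 0]] eventually_happens
      trivial_limit_at_top_linorder by blast
  have "?g ((?g ^^ k) p) \<le> ?g (a *\<^sub>R ?p + b *\<^sub>R ?q) + t *\<^sub>R ?g w"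
    using monoD[OF dir_deriv_mono[OF D(3)] t(2)]
      dir_deriv_add_le[OF D(3), of "a *\<^sub>R ?p + b *\<^sub>R ?q" "t *\<^sub>R w"]
    by (simp add: dir_deriv_scaleR[OF D(3) t(1)])
  then have "(?g ^^ Suc k) p $ i \<le> ?g (a *\<^sub>R ?p + b *\<^sub>R ?q) $ i + t * ?g w $ i"
    by (simp add: vec_le_iff)
  moreover have "t * ?g w $ i \<le> t * w $ i"
    using gw t(1) by (simp add: vec_le_iff mult_left_mono)
  moreover have "w $ i = 0"
    using Suc.prems by (simp add: w_def)
  \<comment> \<open>The equality required by \<open>dir_deriv_compare\<close> holds at
    \<open>i\<close> because \<open>x\<close>, \<open>y\<close>, \<open>z\<close> are fixed and
    \<open>z\<close> agrees with \<open>u\<close> there.\<close>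
  moreover have "?g (a *\<^sub>R ?p + b *\<^sub>R ?q) $ i \<le> a * dir_deriv f x ?p $ i + b * dir_deriv f y ?q $ i"
    using \<open>z \<le> u\<close> Suc.prems u fix_eq by (intro dir_deriv_compare D ab) auto
  ultimately show ?case
    by simp
qed

lemma bdd_above_funpow_dir_deriv:
  assumes "x \<in> t_stable_fixpoints D f" "y \<in> t_stable_fixpoints D f" "z \<in> fixpoints D f"
    and ab: "0 \<le> a" "0 \<le> b" "a + b = (1::real)"
    and "z \<le> a *\<^sub>R x + b *\<^sub>R y" and "z $ i = (a *\<^sub>R x + b *\<^sub>R y) $ i"
  shows "bdd_above (range (\<lambda>k. (dir_deriv f z ^^ k) p $ i))"
proof -
  note x = t_stable_fixpointsD[OF assms(1)] and y = t_stable_fixpointsD[OF assms(2)]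
  obtain c where c: "\<And>k. (dir_deriv f x ^^ k) p $ i \<le> c"
    using x(4)[of p i] by (auto simp: bdd_above_def)
  obtain d where d: "\<And>k. (dir_deriv f y ^^ k) p $ i \<le> d"
    using y(4)[of p i] by (auto simp: bdd_above_def)
  have "(dir_deriv f z ^^ k) p $ i \<le> a * c + b * d" for k
  proof -
    have "(dir_deriv f z ^^ k) p $ i
        \<le> a * (dir_deriv f x ^^ k) p $ i + b * (dir_deriv f y ^^ k) p $ i"
      by (rule funpow_dir_deriv_compare[OF x(1) y(1) assms(3) ab refl assms(7,8)])
    also have "\<dots> \<le> a * c + b * d"
      by (intro add_mono mult_left_mono c d ab)
    finally show ?thesis .
  qed
  then show ?thesis
    by (intro bdd_aboveI2)
qed

text \<open>
  On the coordinates where \<open>z < u\<close>, some iterate of the directional derivative contracts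
  \<open>w = u - z\<close> by a factor of two, which absorbs the bounded contribution of the others.
\<close>
lemma supersolution_limit_t_stable:
  assumes "u \<in> D" "f u \<le> u" and z: "z \<in> fixpoints D f" and "z \<le> u"
    and lim: "(\<lambda>k. (f ^^ k) u) \<longlonglongrightarrow> z"
    and bdd: "\<And>i p. z $ i = u $ i \<Longrightarrow> bdd_above (range (\<lambda>k. (dir_deriv f z ^^ k) p $ i))"
  shows "z \<in> t_stable_fixpoints D f"
proof -
  note zD = fixpointsD[OF z]
  let ?g = "dir_deriv f z"
  note mono_g = dir_deriv_mono[OF zD(1)]
  define w where "w = u - z"
  have w: "0 \<le> w"
    using \<open>z \<le> u\<close> by (simp add: w_def vec_le_iff)
  have gw: "(?g ^^ k) w \<le> (f ^^ k) u - z" for k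
    unfolding w_def using dir_deriv_le_increment[OF zD(1)] zD(2)
    by (intro funpow_increment_ge mono_g assms(1)) simp
  have "\<forall>\<^sub>F k in sequentially. \<forall>i. w $ i \<noteq> 0 \<longrightarrow> (f ^^ k) u $ i - z $ i < w $ i / 2"
  proof (intro eventually_all_finite)
    fix i
    show "\<forall>\<^sub>F k in sequentially. w $ i \<noteq> 0 \<longrightarrow> (f ^^ k) u $ i - z $ i < w $ i / 2"
    proof (cases "w $ i = 0")
      case False
      then have "0 < w $ i / 2"
        using w by (simp add: vec_le_iff order_less_le)
      moreover have "(\<lambda>k. (f ^^ k) u $ i - z $ i) \<longlonglongrightarrow> z $ i - z $ i"
        by (intro tendsto_diff tendsto_vec_nth lim tendsto_const)
      ultimately have "\<forall>\<^sub>F k in sequentially. (f ^^ k) u $ i - z $ i < w $ i / 2"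
        using order_tendstoD(2) by fastforce
      then show ?thesis
        by (rule eventually_mono) simp
    qed simp
  qed
  \<comment> \<open>Positivity of \<open>m\<close> makes \<open>k - m\<close> smaller than
    \<open>k\<close> in the strong induction below.\<close>
  from eventually_happens[OF eventually_conj[OF this eventually_gt_at_top[of 0]]]
  obtain m where m: "0 < m" "\<And>i. w $ i \<noteq> 0 \<Longrightarrow> (f ^^ m) u $ i - z $ i < w $ i / 2"
    by auto
  have half: "(?g ^^ m) w $ i \<le> w $ i / 2" if "w $ i \<noteq> 0" for i
  proof -
    have "(?g ^^ m) w $ i \<le> (f ^^ m) u $ i - z $ i"
      using gw[of m] by (simp add: vec_le_iff)
    with m(2)[OF that] show ?thesis
      by simp
  qed
  have "bdd_above (range (\<lambda>k. (?g ^^ k) p))" for p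
  proof -
    have "\<exists>c. \<forall>i. w $ i = 0 \<longrightarrow> (\<forall>k. (?g ^^ k) p $ i \<le> c i)"
      using bdd by (intro choice) (auto simp: bdd_above_def w_def)
    then obtain c where c: "\<And>i k. w $ i = 0 \<Longrightarrow> (?g ^^ k) p $ i \<le> c i"
      by blast
    \<comment> \<open>\<open>d\<close> holds the known bounds on the zeros of \<open>w\<close>; on
      the remaining coordinates the bound will come from \<open>t w\<close> alone.\<close>
    define d :: "real^'n" where "d = (\<chi> i. if w $ i = 0 then c i else 0)"
    have "\<forall>\<^sub>F t in at_top. (?g ^^ k) p \<le> d + t *\<^sub>R w" for k
      using c by (intro eventually_le_add_scaleR w) (simp add: d_def)
    then have "\<forall>\<^sub>F t in at_top. \<forall>k\<in>{..<m}. (?g ^^ k) p \<le> d + t *\<^sub>R w"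
      by (intro eventually_ball_finite) auto
    \<comment> \<open>The factor 2 reserves half of \<open>t w\<close> for the contribution of
      \<open>d\<close> under \<open>?g ^^ m\<close>; the other half bounds the contracted
      \<open>t w\<close>.\<close>
    moreover have "\<forall>\<^sub>F t in at_top. (\<chi> i. if w $ i = 0 then 0 else 2 * (?g ^^ m) d $ i) \<le> 0 + t *\<^sub>R w"
      by (intro eventually_le_add_scaleR w) simp
    moreover have "\<forall>\<^sub>F t in at_top. (0::real) \<le> t"
      by (rule eventually_ge_at_top)
    ultimately have "\<forall>\<^sub>F t in at_top. (\<forall>k\<in>{..<m}. (?g ^^ k) p \<le> d + t *\<^sub>R w)
        \<and> (\<chi> i. if w $ i = 0 then 0 else 2 * (?g ^^ m) d $ i) \<le> 0 + t *\<^sub>R w \<and> 0 \<le> t"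
      by (intro eventually_conj)
    then obtain t where t: "\<And>k. k < m \<Longrightarrow> (?g ^^ k) p \<le> d + t *\<^sub>R w" "0 \<le> t"
      "(\<chi> i. if w $ i = 0 then 0 else 2 * (?g ^^ m) d $ i) \<le> 0 + t *\<^sub>R w"
      by (auto dest!: eventually_happens)
    have t3: "2 * (?g ^^ m) d $ i \<le> t * w $ i" if "w $ i \<noteq> 0" for i
      using t(3) that by (auto simp: vec_le_iff dest: spec[of _ i])
    \<comment> \<open>A single bound for the whole orbit: \<open>t\<close> was chosen to cover the
      first \<open>m\<close> iterates, and applying \<open>?g ^^ m\<close> to the bound reproduces
      it.\<close>
    have "(?g ^^ k) p \<le> d + t *\<^sub>R w" for k
    proof (induction k rule: less_induct)
      case (less k)
      show ?case
      proof (cases "k < m")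
        case False
        then obtain l where l: "k = m + l"
          using le_Suc_ex by (metis not_less)
        have "(?g ^^ l) p \<le> d + t *\<^sub>R w"
          using less.IH[of l] l m(1) by simp
        then have "(?g ^^ m) ((?g ^^ l) p) \<le> (?g ^^ m) (d + t *\<^sub>R w)"
          by (rule funpow_mono[OF mono_g])
        also have "\<dots> \<le> (?g ^^ m) d + (?g ^^ m) (t *\<^sub>R w)"
          by (rule funpow_dir_deriv_add_le[OF zD(1)])
        also have "\<dots> = (?g ^^ m) d + t *\<^sub>R (?g ^^ m) w"
          by (simp add: funpow_dir_deriv_scaleR[OF zD(1) t(2)])
        finally have step: "(?g ^^ k) p \<le> (?g ^^ m) d + t *\<^sub>R (?g ^^ m) w"
          by (simp add: l funpow_add)
        have "(?g ^^ k) p $ i \<le> (d + t *\<^sub>R w) $ i" for i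
        proof (cases "w $ i = 0")
          case True
          then show ?thesis
            using c by (simp add: d_def)
        next
          case False
          have "(?g ^^ k) p $ i \<le> (?g ^^ m) d $ i + t * (?g ^^ m) w $ i"
            using step by (simp add: vec_le_iff)
          also have "\<dots> \<le> t * w $ i / 2 + t * (w $ i / 2)"
            using t3[OF False] half[OF False] t(2) by (intro add_mono mult_left_mono) auto
          finally show ?thesis
            using False by (simp add: d_def)
        qed
        then show ?thesis
          by (simp add: vec_le_iff)
      qed (use t(1) in simp)
    qed
    then show ?thesis
      by (intro bdd_aboveI2)
  qed
  with z show ?thesis
    by (simp add: t_stable_fixpoints_def)
qed

section \<open>Subgradients and critical coordinates\<close>

lemma subdifferential_nonneg:
  assumes "v \<in> D" "P \<in> subdifferential D f v"
  shows "0 \<le> P $ i $ j"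
proof -
  \<comment> \<open>Lowering one coordinate stays in the downward set \<open>D\<close> and does not
    increase \<open>f\<close>, so column \<open>j\<close> of \<open>P\<close> with its sign reversed
    is at most 0.\<close>
  let ?x = "v - axis j 1"
  have "?x \<le> v"
    by (simp add: vec_le_iff axis_def)
  moreover from this have "?x \<in> D"
    using below_mem assms(1) by blast
  ultimately have "f ?x \<le> f v"
    using assms(1) mono_onD[OF mono_f] by blast
  moreover have "P *v (?x - v) \<le> f ?x - f v"
    using assms(2) \<open>?x \<in> D\<close> unfolding subdifferential_def by blast
  ultimately have "(P *v (- axis j 1)) $ i \<le> 0"
    by (auto simp: vec_le_iff intro: order_trans)
  then show ?thesis
    by (simp add: matrix_vector_mult_def axis_def sum_negf if_distrib cong: if_cong)
qed

text \<open>With \<open>d = u - v\<close> and \<open>l\<close> the limit of \<open>P^k d\<close>,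
  there is a sandwich \<open>l <= z - v <= d\<close>, and its two ends coincide on the critical
  nodes of \<open>P\<close>.\<close>

lemma supersolution_limit_eq_on_critical_nodes:
  assumes "u \<in> D" "f u \<le> u" and v: "v \<in> t_stable_fixpoints D f"
    and lim: "(\<lambda>k. (f ^^ k) u) \<longlonglongrightarrow> z" and "z \<le> u"
    and "i \<in> critical_nodes D f v"
  shows "z $ i = u $ i"
proof -
  note v' = t_stable_fixpointsD[OF v]
  obtain P where P: "P \<in> subdifferential D f v" and i: "i \<in> matrix_critical_nodes P"
    using assms(6) by (auto simp: critical_nodes_def)
  note nonneg = subdifferential_nonneg[OF v'(2) P]
  note mono_P = nonneg_matrix_mult_mono[of P, OF nonneg]
  have P_le: "P *v y \<le> f (v + y) - v" if "v + y \<in> D" for y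
    using P that v'(3) by (auto simp: subdifferential_def dest: bspec[of _ _ "v + y"])
  \<comment> \<open>This transfers t-stability to \<open>P\<close>: powers of \<open>P\<close> lie
    below iterates of the derivative, and by linearity the upper bound on the orbit of
    \<open>- d\<close> is a lower bound on that of \<open>d\<close>.\<close>
  have P_le_deriv: "P *v y \<le> dir_deriv f v y" for y
    unfolding vec_le_iff
  proof
    fix j
    have "\<forall>\<^sub>F \<epsilon> in at_right (0::real). 0 < \<epsilon>"
      by (auto simp: eventually_at_right_field intro!: exI[of _ 1])
    with eventually_mem[OF v'(2), of y]
    have "\<forall>\<^sub>F \<epsilon> in at_right 0. (P *v y) $ j \<le> ((f (v + \<epsilon> *\<^sub>R y) - f v) /\<^sub>R \<epsilon>) $ j"
    proof eventually_elim
      case (elim \<epsilon>)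
      then have "\<epsilon> * (P *v y) $ j \<le> f (v + \<epsilon> *\<^sub>R y) $ j - f v $ j"
        using P_le[of "\<epsilon> *\<^sub>R y"] v'(3) by (simp add: vec_le_iff matrix_vector_mult_scaleR)
      then show ?case
        using elim by (simp add: field_simps)
    qed
    then show "(P *v y) $ j \<le> dir_deriv f v y $ j"
      by (intro tendsto_lowerbound[OF tendsto_vec_nth[OF has_dir_deriv[OF v'(2)]]]) auto
  qed
  have pow_le: "(((*v) P) ^^ k) y \<le> (dir_deriv f v ^^ k) y" for k y
  proof (induction k)
    case (Suc k)
    show ?case
      using order_trans[OF P_le_deriv monoD[OF dir_deriv_mono[OF v'(2)] Suc]] by simp
  qed simp
  define d where "d = u - v"
  have "P *v d \<le> f u - v"
    using P_le[of d] assms(1) by (simp add: d_def)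
  also have "\<dots> \<le> d"
    using assms(2) by (simp add: d_def vec_le_iff)
  finally have "P *v d \<le> d" .
  then have dec: "(((*v) P) ^^ Suc k) d \<le> (((*v) P) ^^ k) d" for k
    using funpow_mono[OF mono_P, of "P *v d" d k] by (simp add: funpow_swap1)
  have "\<exists>c. \<forall>j k. (dir_deriv f v ^^ k) (- d) $ j \<le> c j"
    using v'(4) by (intro choice) (auto simp: bdd_above_def)
  then obtain c where c: "\<And>j k. (dir_deriv f v ^^ k) (- d) $ j \<le> c j"
    by blast
  have "- (\<chi> j. c j) \<le> (((*v) P) ^^ k) d" for k
  proof -
    have "(((*v) P) ^^ k) (- d) $ j \<le> c j" for j
      using pow_le[of k "- d"] c[of k j] unfolding vec_le_iff by (meson order_trans)
    moreover have "(((*v) P) ^^ k) (- d) = - (((*v) P) ^^ k) d"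
      using funpow_matrix_scaleR[of k P "- 1" d] by simp
    ultimately have "- (((*v) P) ^^ k) d $ j \<le> c j" for j
      by simp
    then have "- c j \<le> (((*v) P) ^^ k) d $ j" for j
      by (simp add: minus_le_iff)
    then show ?thesis
      by (simp add: vec_le_iff)
  qed
  then obtain l where l: "(\<lambda>k. (((*v) P) ^^ k) d) \<longlonglongrightarrow> l" "\<And>k. l \<le> (((*v) P) ^^ k) d"
    using decreasing_vec_convergent[of "\<lambda>k. (((*v) P) ^^ k) d"] dec by metis
  have "(\<lambda>k. (((*v) P) ^^ Suc k) d) \<longlonglongrightarrow> P *v l"
    using isCont_tendsto_compose[OF _ l(1), of "(*v) P"]
    by (simp add: linear_continuous_at matrix_vector_mul_bounded_linear)
  then have Pl: "P *v l = l"
    using LIMSEQ_Suc[OF l(1)] LIMSEQ_unique by blast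
  then have pow_l: "(((*v) P) ^^ k) l = l" for k
    by (induction k) auto
  have "(d - l) $ i = 0"
  proof (rule contracted_vanishes_on_critical_nodes[OF nonneg _ _ _ i])
    show "0 \<le> d - l"
      using l(2)[of 0] by (simp add: vec_le_iff)
    show "P *v (d - l) \<le> d - l"
      using \<open>P *v d \<le> d\<close> by (simp add: matrix_vector_mult_diff_distrib Pl vec_le_iff)
    show "(\<lambda>k. (((*v) P) ^^ k) (d - l)) \<longlonglongrightarrow> 0"
      using tendsto_diff[OF l(1) tendsto_const[of l]] by (simp add: funpow_matrix_diff pow_l)
  qed
  moreover have "l \<le> (f ^^ k) u - v" for k
  proof -
    have "(((*v) P) ^^ k) d \<le> (f ^^ k) u - v"
      unfolding d_def by (rule funpow_increment_ge[OF mono_P _ assms(1)]) (rule P_le)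
    with l(2)[of k] show ?thesis
      by (rule order_trans)
  qed
  then have "l \<le> z - v"
    using vec_LIMSEQ_ge_const[OF tendsto_diff[OF lim tendsto_const[of v]]] by blast
  ultimately show ?thesis
    using \<open>z \<le> u\<close> by (auto simp: vec_le_iff d_def intro!: order.antisym dest: spec[of _ i])
qed

section \<open>The meet on the t-stable fixed points, and restriction to the critical
  coordinates\<close>

lemma inf_supersolution:
  assumes "x \<in> fixpoints D f" "y \<in> fixpoints D f"
  shows "inf x y \<in> D" "f (inf x y) \<le> inf x y"
proof -
  note x = fixpointsD[OF assms(1)] and y = fixpointsD[OF assms(2)]
  show *: "inf x y \<in> D"
    using below_mem[OF x(1)] by simp
  show "f (inf x y) \<le> inf x y"
    using mono_onD[OF mono_f * x(1)] mono_onD[OF mono_f * y(1)] x(2) y(2) by simp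
qed

lemma fix_meet_limit:
  assumes "x \<in> t_stable_fixpoints D f" "y \<in> t_stable_fixpoints D f"
  shows "(\<lambda>k. (f ^^ k) (inf x y)) \<longlonglongrightarrow> fix_meet f x y" "fix_meet f x y \<le> inf x y"
    and "fix_meet f x y \<in> t_stable_fixpoints D f"
proof -
  note fixpts = t_stable_fixpointsD(1)[OF assms(1)] t_stable_fixpointsD(1)[OF assms(2)]
  note super = inf_supersolution[OF fixpts]
  obtain z where z: "(\<lambda>k. (f ^^ k) (inf x y)) \<longlonglongrightarrow> z" "z \<le> inf x y" "z \<in> fixpoints D f"
    using supersolution_limit[OF super assms(1)] by blast
  then have eq: "fix_meet f x y = z"
    by (simp add: fix_meet_def limI)
  have "z \<in> t_stable_fixpoints D f"
  \<comment> \<open>Each coordinate where \<open>z\<close> agrees with the minimum is compared with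
    a single fixed point attaining it, using the degenerate weights 1 and 0.\<close>
  proof (rule supersolution_limit_t_stable[OF super z(3,2,1)])
    fix i p
    assume "z $ i = inf x y $ i"
    then consider "z $ i = x $ i" | "z $ i = y $ i"
      by (auto simp: inf_vec_def inf_real_def min_def split: if_splits)
    then show "bdd_above (range (\<lambda>k. (dir_deriv f z ^^ k) p $ i))"
    proof cases
      case 1
      then show ?thesis
        using z(2) bdd_above_funpow_dir_deriv[OF assms(1,1) z(3), of 1 0 i p] by simp
    next
      case 2
      then show ?thesis
        using z(2) bdd_above_funpow_dir_deriv[OF assms(2,2) z(3), of 1 0 i p] by simp
    qed
  qed
  with z eq show "(\<lambda>k. (f ^^ k) (inf x y)) \<longlonglongrightarrow> fix_meet f x y" "fix_meet f x y \<le> inf x y"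
    "fix_meet f x y \<in> t_stable_fixpoints D f"
    by simp_all
qed

text \<open>By monotonicity a fixed point below \<open>x\<close> and \<open>y\<close> stays below
  every iterate of \<open>inf x y\<close>. Hence \<open>fix_meet\<close> is a greatest lower bound
  among the t-stable fixed points, which yields associativity and idempotence.\<close>

lemma fix_meet_greatest:
  assumes "x \<in> t_stable_fixpoints D f" "y \<in> t_stable_fixpoints D f"
    and "u \<in> fixpoints D f" "u \<le> x" "u \<le> y"
  shows "u \<le> fix_meet f x y"
proof (rule vec_LIMSEQ_ge_const[OF fix_meet_limit(1)[OF assms(1,2)]])
  note fixpts = t_stable_fixpointsD(1)[OF assms(1)] t_stable_fixpointsD(1)[OF assms(2)]
  fix k
  show "u \<le> (f ^^ k) (inf x y)"
  proof (induction k)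
    case (Suc k)
    show ?case
      using mono_onD[OF mono_f fixpointsD(1)[OF assms(3)]
          supersolution_orbit(1)[OF inf_supersolution[OF fixpts], of k] Suc]
        fixpointsD(2)[OF assms(3)]
      by simp
  qed (use assms in simp)
qed

lemma inf_semilattice_fix_meet: "inf_semilattice_on (t_stable_fixpoints D f) (fix_meet f)"
proof -
  let ?E = "t_stable_fixpoints D f"
  have closed: "fix_meet f x y \<in> ?E" and le1: "fix_meet f x y \<le> x" and le2: "fix_meet f x y \<le> y"
    if "x \<in> ?E" "y \<in> ?E" for x y
    using fix_meet_limit(2,3)[OF that] by auto
  have greatest: "u \<le> fix_meet f x y" if "x \<in> ?E" "y \<in> ?E" "u \<in> ?E" "u \<le> x" "u \<le> y" for x y u
    using fix_meet_greatest that t_stable_fixpointsD(1) by blast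
  have "fix_meet f (fix_meet f x y) z = fix_meet f x (fix_meet f y z)"
    if xyz: "x \<in> ?E" "y \<in> ?E" "z \<in> ?E" for x y z
  proof (rule order.antisym)
    note E = closed[OF xyz(1,2)] closed[OF xyz(2,3)]
    note lower = le1[OF E(1) xyz(3)] le2[OF E(1) xyz(3)] le1[OF xyz(1) E(2)] le2[OF xyz(1) E(2)]
      le1[OF xyz(1,2)] le2[OF xyz(1,2)] le1[OF xyz(2,3)] le2[OF xyz(2,3)]
    show "fix_meet f (fix_meet f x y) z \<le> fix_meet f x (fix_meet f y z)"
      by (intro greatest closed xyz order_trans[OF lower(1) lower(5)]
          order_trans[OF lower(1) lower(6)] lower(2))
    show "fix_meet f x (fix_meet f y z) \<le> fix_meet f (fix_meet f x y) z"
      by (intro greatest closed xyz order_trans[OF lower(4) lower(7)]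
          order_trans[OF lower(4) lower(8)] lower(3))
  qed
  moreover have "fix_meet f x y = fix_meet f y x" for x y
    by (simp add: fix_meet_def inf_commute)
  moreover have "fix_meet f x x = x" if "x \<in> ?E" for x
    by (intro order.antisym le1 greatest that order_refl)
  ultimately show ?thesis
    using closed by (simp add: inf_semilattice_on_def)
qed

text \<open>A convex combination of fixed points is only known to be a supersolution; replacing it
  by the limit of its orbit gives a t-stable fixed point with the same critical coordinates.\<close>

lemma convex_restrict_t_stable_fixpoints:
  assumes v: "v \<in> t_stable_fixpoints D f"
  shows "convex (restrict_coords (critical_nodes D f v) ` t_stable_fixpoints D f)"
proof (rule convexI)
  let ?E = "t_stable_fixpoints D f" and ?r = "restrict_coords (critical_nodes D f v)"
  fix x' y' :: "real^'n" and a b :: real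
  assume "x' \<in> ?r ` ?E" "y' \<in> ?r ` ?E" and ab: "0 \<le> a" "0 \<le> b" "a + b = 1"
  then obtain x y where xy: "x \<in> ?E" "y \<in> ?E" "x' = ?r x" "y' = ?r y"
    by blast
  note x = t_stable_fixpointsD[OF xy(1)] and y = t_stable_fixpointsD[OF xy(2)]
  define u where "u = a *\<^sub>R x + b *\<^sub>R y"
  have u: "u \<in> D" "f u \<le> u"
    using convex_combination[OF x(2) y(2) ab] x(3) y(3) by (simp_all add: u_def)
  obtain z where z: "(\<lambda>k. (f ^^ k) u) \<longlonglongrightarrow> z" "z \<le> u" "z \<in> fixpoints D f"
    using supersolution_limit[OF u v] by blast
  have "z \<in> ?E"
    using bdd_above_funpow_dir_deriv[OF xy(1,2) z(3) ab] z(2)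
    by (intro supersolution_limit_t_stable[OF u z(3,2,1)]) (simp add: u_def)
  moreover have "?r z = a *\<^sub>R x' + b *\<^sub>R y'"
    using supersolution_limit_eq_on_critical_nodes[OF u v z(1,2)]
    by (simp add: restrict_coords_def xy Finite_Cartesian_Product.vec_eq_iff u_def)
  ultimately show "a *\<^sub>R x' + b *\<^sub>R y' \<in> ?r ` ?E"
    by (metis imageI)
qed

text \<open>Passing from \<open>inf x y\<close> to the limit of its orbit changes no critical
  coordinate.\<close>

lemma restrict_coords_fix_meet:
  assumes "v \<in> t_stable_fixpoints D f" "x \<in> t_stable_fixpoints D f" "y \<in> t_stable_fixpoints D f"
  shows "restrict_coords (critical_nodes D f v) (fix_meet f x y)
    = inf (restrict_coords (critical_nodes D f v) x) (restrict_coords (critical_nodes D f v) y)"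
proof -
  note super = inf_supersolution[OF t_stable_fixpointsD(1)[OF assms(2)] t_stable_fixpointsD(1)[OF assms(3)]]
  show ?thesis
    using supersolution_limit_eq_on_critical_nodes[OF super assms(1) fix_meet_limit(1,2)[OF assms(2,3)]]
    by (simp add: restrict_coords_def Finite_Cartesian_Product.vec_eq_iff inf_vec_def)
qed

end

text \<open>The convergence clause ensures that \<open>fix_meet\<close> is a genuine limit and not
  an unspecified value of \<open>lim\<close>. For \<open>inf\<close>, the semilattice clause amounts
  to closure, the other laws holding in all of \<open>real^'n\<close>.\<close>

theorem theorem7p3:
  fixes D :: "(real^'n) set" and f :: "real^'n \<Rightarrow> real^'n" and v :: "real^'n"
    and C :: "'n set"
  assumes "open D" and "convex D" and "downward D"
    and "f ` D \<subseteq> D" and "convex_map_on D f" and "mono_on D f"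
    and "v \<in> t_stable_fixpoints D f"
    and "C = critical_nodes D f v"
  shows "(\<forall>x\<in>t_stable_fixpoints D f. \<forall>y\<in>t_stable_fixpoints D f.
            convergent (\<lambda>k. (f ^^ k) (inf x y)))
       \<and> inf_semilattice_on (t_stable_fixpoints D f) (fix_meet f)
       \<and> convex (restrict_coords C ` t_stable_fixpoints D f)
       \<and> inf_semilattice_on (restrict_coords C ` t_stable_fixpoints D f) inf"
proof -
  interpret convex_monotone_map D f
    by unfold_locales (fact assms)+
  let ?E = "t_stable_fixpoints D f"
  have "inf x' y' \<in> restrict_coords C ` ?E"
    if "x' \<in> restrict_coords C ` ?E" "y' \<in> restrict_coords C ` ?E" for x' y'
  proof -
    obtain x y where "x \<in> ?E" "y \<in> ?E" "x' = restrict_coords C x" "y' = restrict_coords C y"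
      using \<open>x' \<in> _\<close> \<open>y' \<in> _\<close> by blast
    then show ?thesis
      using restrict_coords_fix_meet[OF assms(7)] fix_meet_limit(3) assms(8) by force
  qed
  then have "inf_semilattice_on (restrict_coords C ` ?E) inf"
    by (simp add: inf_semilattice_on_def inf_assoc) (simp add: inf_commute)
  then show ?thesis
    using fix_meet_limit(1) inf_semilattice_fix_meet convex_restrict_t_stable_fixpoints[OF assms(7)]
      assms(8) by (auto simp: convergent_def)
qed

end
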